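(* The staircase form with row and column support lengths $(3n)_{n\ge1}$, i.e. the matrix form whose support entries are exactly the positions $(i,j)\in\mathbb N\times\mathbb N$ with $i\le3j$ and $j\le3i$, has density $2/3$.
   Context: $\mathbb N=\{1,2,\dots\}$. A matrix form is specified by a set of positions $(i,j)\in\mathbb N\times\mathbb N$ at which matrices of the form must be zero; the positions in the complement are its support entries. For $N\in\mathbb N$, $L_N$ denotes the number of support entries $(i,j)$ with $1\le i,j\le N$. The density of the form is $\lim_{N\to\infty}L_N/N^2$, whenever this limit exists. *)

theory Defs
  imports Complex_Main
begin

text \<open>Indices start at 1, so the index set is \<open>{1..} :: nat set\<close>.\<close>

definition positions :: "(nat \<times> nat) set" where
  "positions = {1..} \<times> {1..}"

text \<open>A matrix form is given by the set of positions \<open>Z \<subseteq> positions\<close> at which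
  matrices of the form must vanish.\<close>

type_synonym matrix_form = "(nat \<times> nat) set"

definition support_entries :: "matrix_form \<Rightarrow> (nat \<times> nat) set" where
  "support_entries Z = positions - Z"

definition support_count :: "matrix_form \<Rightarrow> nat \<Rightarrow> nat" where
  "support_count Z N = card (support_entries Z \<inter> {1..N} \<times> {1..N})"

text \<open>The density exists and equals \<open>d\<close>.\<close>

definition has_density :: "matrix_form \<Rightarrow> real \<Rightarrow> bool" where
  "has_density Z d \<longleftrightarrow> (\<lambda>N. real (support_count Z N) / (real N)\<^sup>2) \<longlonglongrightarrow> d"

text \<open>Row \<open>i\<close> is forced to vanish beyond column \<open>r i\<close>, and column \<open>j\<close> is forced to
  vanish below row \<open>c j\<close>.\<close>

definition staircase_form :: "(nat \<Rightarrow> nat) \<Rightarrow> (nat \<Rightarrow> nat) \<Rightarrow> matrix_form" where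
  "staircase_form r c = {(i, j) \<in> positions. r i < j \<or> c j < i}"

lemma support_entries_staircase_form:
  "support_entries (staircase_form r c) = {(i, j). 1 \<le> i \<and> 1 \<le> j \<and> i \<le> c j \<and> j \<le> r i}"
  by (auto simp: support_entries_def staircase_form_def positions_def)

end

theory Submission imports Defs begin

text \<open>
  The support of the staircase form of slope \<open>m \<ge> 1\<close> inside the square \<open>{1..N} \<times> {1..N}\<close> is the
  square with two disjoint congruent wedges removed: the positions with \<open>j > m * i\<close>, and their
  mirror image in the diagonal. In column \<open>j\<close> the wedge above the diagonal has
  \<open>(j - 1) div m\<close> positions, so the whole wedge has \<open>\<Sum>k<N. k div m\<close>. Dropping the rounding
  changes each of the \<open>N\<close> summands by at most \<open>1\<close>, hence the wedge has size
  \<open>N * (N - 1) / (2 * m)\<close> up to an error of at most \<open>N\<close>. Each wedge thus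
  takes the proportion \<open>1 / (2 * m)\<close> of the square in the limit, and the density is \<open>1 - 1 / m\<close>,
  which is \<open>2 / 3\<close> for slope \<open>3\<close>.
\<close>

definition upper_wedge :: "nat \<Rightarrow> nat \<Rightarrow> (nat \<times> nat) set" where
  "upper_wedge m N = {(i, j). 1 \<le> i \<and> m * i < j \<and> j \<le> N}"

text \<open>Summing over the columns: in column \<open>j = Suc k\<close> the inequality \<open>m * i < j\<close> becomes
  \<open>i \<le> k div m\<close>.\<close>

lemma card_upper_wedge:
  assumes "m \<ge> 1"
  shows "card (upper_wedge m N) = (\<Sum>k<N. k div m)"
proof -
  have column: "1 \<le> i \<and> m * i < Suc k \<longleftrightarrow> i \<in> {1..k div m}" for i k
    using assms by (auto simp: less_Suc_eq_le less_eq_div_iff_mult_less_eq mult.commute)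
  have "upper_wedge m N = (\<lambda>(k, i). (i, Suc k)) ` (SIGMA k:{..<N}. {1..k div m})"
  proof (intro set_eqI iffI)
    fix p assume "p \<in> upper_wedge m N"
    then obtain i k where p: "p = (i, Suc k)" "1 \<le> i" "m * i < Suc k" "k < N"
      by (cases p, case_tac b) (auto simp: upper_wedge_def)
    then show "p \<in> (\<lambda>(k, i). (i, Suc k)) ` (SIGMA k:{..<N}. {1..k div m})"
      using column[of i k] by (intro image_eqI[of _ _ "(k, i)"]) auto
  next
    fix p assume "p \<in> (\<lambda>(k, i). (i, Suc k)) ` (SIGMA k:{..<N}. {1..k div m})"
    then obtain i k where "p = (i, Suc k)" "k < N" "i \<in> {1..k div m}"
      by auto
    then show "p \<in> upper_wedge m N"
      using column[of i k] by (simp add: upper_wedge_def)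
  qed
  moreover have "inj_on (\<lambda>(k, i). (i, Suc k)) (SIGMA k:{..<N}. {1..k div m})"
    by (auto simp: inj_on_def)
  ultimately show ?thesis
    by (simp add: card_image)
qed

lemma sum_div_bounds:
  fixes m N :: nat
  shows "real (\<Sum>k<N. k div m) \<le> real N * (real N - 1) / (2 * real m)"
    and "real N * (real N - 1) / (2 * real m) - real N \<le> real (\<Sum>k<N. k div m)"
proof -
  have "(\<Sum>k<N. real k) = real N * (real N - 1) / 2"
    by (induction N) (auto simp: field_simps)
  then have exact: "(\<Sum>k<N. real k / real m) = real N * (real N - 1) / (2 * real m)"
    by (simp flip: sum_divide_distrib divide_divide_eq_left)
  have rounding: "real (k div m) \<le> real k / real m" "real k / real m - 1 \<le> real (k div m)" for k
    using floor_correct[of "real k / real m"] by (simp_all add: floor_divide_of_nat_eq)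
  have "real (\<Sum>k<N. k div m) \<le> (\<Sum>k<N. real k / real m)"
    using rounding(1) by (simp add: sum_mono)
  then show "real (\<Sum>k<N. k div m) \<le> real N * (real N - 1) / (2 * real m)"
    using exact by simp
  have "(\<Sum>k<N. real k / real m - 1) \<le> (\<Sum>k<N. real (k div m))"
    using rounding(2) by (intro sum_mono)
  then show "real N * (real N - 1) / (2 * real m) - real N \<le> real (\<Sum>k<N. k div m)"
    using exact by (simp add: sum_subtractf)
qed

text \<open>The two wedges do not meet, since \<open>m * i < j\<close> and \<open>m * j < i\<close> would give \<open>i < j < i\<close>;
  reflection in the diagonal shows that they have the same size.\<close>

lemma support_count_staircase_linear:
  assumes "m \<ge> 1"
  shows "support_count (staircase_form (\<lambda>n. m * n) (\<lambda>n. m * n)) N + 2 * (\<Sum>k<N. k div m) = N\<^sup>2"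
proof -
  let ?S = "support_entries (staircase_form (\<lambda>n. m * n) (\<lambda>n. m * n)) \<inter> {1..N} \<times> {1..N}"
  let ?U = "upper_wedge m N"
  let ?L = "prod.swap ` ?U"
  have slope: "x \<le> m * x" for x
    using assms by simp
  have square: "{1..N} \<times> {1..N} = ?S \<union> (?U \<union> ?L)"
  proof (intro set_eqI iffI)
    fix p assume "p \<in> {1..N} \<times> {1..N}"
    then show "p \<in> ?S \<union> (?U \<union> ?L)"
      by (cases p) (auto simp: support_entries_staircase_form upper_wedge_def image_iff)
  next
    fix p assume "p \<in> ?S \<union> (?U \<union> ?L)"
    then show "p \<in> {1..N} \<times> {1..N}"
      using le_trans[OF slope] by (auto simp: upper_wedge_def intro: less_imp_le)
  qed
  have disjoint_support: "?S \<inter> (?U \<union> ?L) = {}"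
    by (auto simp: support_entries_staircase_form upper_wedge_def)
  have disjoint_wedges: "?U \<inter> ?L = {}"
  proof -
    have False if "m * i < j" "m * j < i" for i j
      using that slope[of i] slope[of j] by linarith
    then show ?thesis
      by (auto simp: upper_wedge_def)
  qed
  have finite: "finite ?S" "finite ?U" "finite ?L"
    using square by (metis finite_Un finite_SigmaI finite_atLeastAtMost)+
  have "N\<^sup>2 = card ({1..N} \<times> {1..N})"
    by (simp add: power2_eq_square)
  also have "\<dots> = card ?S + card (?U \<union> ?L)"
    using square card_Un_disjoint[OF _ _ disjoint_support] finite by simp
  also have "card (?U \<union> ?L) = card ?U + card ?L"
    using finite disjoint_wedges by (intro card_Un_disjoint)
  also have "card ?L = card ?U"
    by (simp add: card_image)
  finally show ?thesis
    using card_upper_wedge[OF assms] by (simp add: support_count_def)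
qed

lemma has_density_staircase_linear:
  assumes "m \<ge> 1"
  shows "has_density (staircase_form (\<lambda>n. m * n) (\<lambda>n. m * n)) (1 - 1 / real m)"
proof -
  define L where "L N = real (support_count (staircase_form (\<lambda>n. m * n) (\<lambda>n. m * n)) N)" for N
  have count: "L N = (real N)\<^sup>2 - 2 * real (\<Sum>k<N. k div m)" for N
    using arg_cong[OF support_count_staircase_linear[OF assms, of N], of real]
    by (simp add: L_def)
  have error: "\<bar>L N / (real N)\<^sup>2 - (1 - 1 / real m)\<bar> \<le> 3 / real N" if "N > 0" for N
  proof -
    have main_term: "2 * (real N * (real N - 1) / (2 * real m))
        = (real N)\<^sup>2 / real m - real N / real m"
      using assms by (simp add: field_simps power2_eq_square)
    have "real N / real m \<le> real N" "0 \<le> real N / real m"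
      using assms by (simp_all add: divide_le_eq mult_le_cancel_left1)
    then have "\<bar>L N - ((real N)\<^sup>2 - (real N)\<^sup>2 / real m)\<bar> \<le> 3 * real N"
      using sum_div_bounds[where m = m and N = N] main_term count[of N] by linarith
    then have "\<bar>L N - ((real N)\<^sup>2 - (real N)\<^sup>2 / real m)\<bar> / (real N)\<^sup>2 \<le> 3 * real N / (real N)\<^sup>2"
      by (rule divide_right_mono) simp
    moreover have "L N / (real N)\<^sup>2 - (1 - 1 / real m)
        = (L N - ((real N)\<^sup>2 - (real N)\<^sup>2 / real m)) / (real N)\<^sup>2"
      using that by (simp add: diff_divide_distrib)
    ultimately show ?thesis
      using that by (simp add: power2_eq_square)
  qed
  have "(\<lambda>N. L N / (real N)\<^sup>2 - (1 - 1 / real m)) \<longlonglongrightarrow> 0"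
  proof (rule tendsto_0_le[where K = 1])
    show "\<forall>\<^sub>F N in sequentially. norm (L N / (real N)\<^sup>2 - (1 - 1 / real m)) \<le> norm (3 / real N) * 1"
      using eventually_gt_at_top[of 0] by eventually_elim (use error in simp)
    show "(\<lambda>N. 3 / real N) \<longlonglongrightarrow> 0"
      by (rule lim_const_over_n)
  qed
  then show ?thesis
    by (simp only: has_density_def L_def flip: LIM_zero_iff[of _ "1 - 1 / real m"])
qed

theorem theorem5p1:
  shows "has_density (staircase_form (\<lambda>n. 3 * n) (\<lambda>n. 3 * n)) (2 / 3)"
  using has_density_staircase_linear[of 3] by simp

end
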